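(* Let $A$ be a $k$-element set ($k$ a positive integer) and let $\mathcal{C}$ be a clone on $A$. If $\mathcal{C}\in\mathfrak{F}_A$, then there exists a positive constant $c$ such that $|\mathcal{C}^{(n)}|\geq c\,k^{k^n/n}$ for all $n\geq 1$.
   Context: For $n\ge 1$, an $n$-ary operation on $A$ is a function $A^n\to A$; $\mathcal{O}_A$ is the set of all finitary operations on $A$, and $\mathcal{C}^{(n)}$ is the set of $n$-ary members of $\mathcal{C}\subseteq\mathcal{O}_A$. A clone on $A$ is a set $\mathcal{C}\subseteq\mathcal{O}_A$ containing all projections and closed under composition. For a clone $\mathcal{C}$, an $n$-ary $f$ and an $m$-ary $g$ in $\mathcal{O}_A$, write $f\leq_{\mathcal{C}} g$ if $f=g(h_1,\dots,h_m)$ for some $h_1,\dots,h_m\in\mathcal{C}^{(n)}$, and $f\equiv_{\mathcal{C}}g$ if $f\leq_{\mathcal{C}}g$ and $g\leq_{\mathcal{C}}f$. $\mathfrak{F}_A$ denotes the set of all clones $\mathcal{C}$ on $A$ such that the equivalence relation $\equiv_{\mathcal{C}}$ on $\mathcal{O}_A$ has only finitely many classes. The exponent in $k^{k^n/n}$ is the real number $k^n/n$. *)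

theory Defs
  imports Complex_Main "HOL-Library.FuncSet"
begin

(* An n-tuple over A is a list of length n with entries in A. *)
definition tuples :: "'a set \<Rightarrow> nat \<Rightarrow> 'a list set" where
  "tuples A n = {xs. length xs = n \<and> set xs \<subseteq> A}"

(* Functions A^n \<rightarrow> A are extensional (fixed to "undefined" outside A^n), so that equality in HOL
   is equality of operations and cardinalities are the intended ones. *)
definition operations :: "'a set \<Rightarrow> nat \<Rightarrow> ('a list \<Rightarrow> 'a) set" where
  "operations A n = (tuples A n \<rightarrow>\<^sub>E A)"

(* A finitary operation carries its arity as the first component. *)
type_synonym 'a operation = "nat \<times> ('a list \<Rightarrow> 'a)"

definition finitary_operations :: "'a set \<Rightarrow> 'a operation set" where
  "finitary_operations A = {(n, f). n \<ge> 1 \<and> f \<in> operations A n}"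

definition nary_part :: "'a operation set \<Rightarrow> nat \<Rightarrow> ('a list \<Rightarrow> 'a) set" where
  "nary_part C n = {f. (n, f) \<in> C}"

(* Arguments are numbered from 0. *)
definition projection :: "'a set \<Rightarrow> nat \<Rightarrow> nat \<Rightarrow> ('a list \<Rightarrow> 'a)" where
  "projection A n i = (\<lambda>xs \<in> tuples A n. xs ! i)"

(* The n-ary operation f(g_1, ..., g_m), where gs = [g_1, ..., g_m] are n-ary and f is m-ary. *)
definition compose_op ::
    "'a set \<Rightarrow> nat \<Rightarrow> ('a list \<Rightarrow> 'a) \<Rightarrow> ('a list \<Rightarrow> 'a) list \<Rightarrow> ('a list \<Rightarrow> 'a)" where
  "compose_op A n f gs = (\<lambda>xs \<in> tuples A n. f (map (\<lambda>g. g xs) gs))"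

definition clone :: "'a set \<Rightarrow> 'a operation set \<Rightarrow> bool" where
  "clone A C \<longleftrightarrow>
     C \<subseteq> finitary_operations A \<and>
     (\<forall>n i. i < n \<longrightarrow> projection A n i \<in> nary_part C n) \<and>
     (\<forall>m n f gs. m \<ge> 1 \<longrightarrow> n \<ge> 1 \<longrightarrow> f \<in> nary_part C m \<longrightarrow>
        length gs = m \<longrightarrow> set gs \<subseteq> nary_part C n \<longrightarrow>
        compose_op A n f gs \<in> nary_part C n)"

definition minor_le :: "'a set \<Rightarrow> 'a operation set \<Rightarrow> 'a operation \<Rightarrow> 'a operation \<Rightarrow> bool" where
  "minor_le A C = (\<lambda>(n, f) (m, g).
     \<exists>hs. length hs = m \<and> set hs \<subseteq> nary_part C n \<and> f = compose_op A n g hs)"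

definition minor_equiv :: "'a set \<Rightarrow> 'a operation set \<Rightarrow> ('a operation \<times> 'a operation) set" where
  "minor_equiv A C =
     {(p, q). p \<in> finitary_operations A \<and> q \<in> finitary_operations A \<and>
              minor_le A C p q \<and> minor_le A C q p}"

definition finite_class_clones :: "'a set \<Rightarrow> 'a operation set set" where
  "finite_class_clones A =
     {C. clone A C \<and> finite (finitary_operations A // minor_equiv A C)}"

lemma minor_le_refl:
  assumes C: "clone A C" and p: "p \<in> finitary_operations A"
  shows "minor_le A C p p"
proof -
  obtain n f where nf: "p = (n, f)" "f \<in> operations A n"
    using p by (auto simp: finitary_operations_def)
  let ?hs = "map (projection A n) [0..<n]"
  have "set ?hs \<subseteq> nary_part C n"
    using C by (auto simp: clone_def)
  moreover have "f = compose_op A n f ?hs"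
  proof
    fix xs
    have "map (\<lambda>g. g xs) ?hs = xs" if "xs \<in> tuples A n"
      using that by (auto intro!: nth_equalityI simp: projection_def tuples_def)
    then show "f xs = compose_op A n f ?hs xs"
      using nf by (auto simp: compose_op_def operations_def PiE_def extensional_def)
  qed
  ultimately show ?thesis
    unfolding nf minor_le_def by (auto intro!: exI[of _ ?hs])
qed

lemma minor_le_trans:
  assumes C: "clone A C" and "p \<in> finitary_operations A" "q \<in> finitary_operations A"
    and pq: "minor_le A C p q" and qr: "minor_le A C q r"
  shows "minor_le A C p r"
proof -
  obtain n f m g l h where eqs: "p = (n, f)" "q = (m, g)" "r = (l, h)"
    by (metis surj_pair)
  have nm: "n \<ge> 1" "m \<ge> 1"
    using assms(2,3) by (auto simp: eqs finitary_operations_def)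
  obtain gs where gs: "length gs = m" "set gs \<subseteq> nary_part C n" "f = compose_op A n g gs"
    using pq by (auto simp: eqs minor_le_def)
  obtain hs where hs: "length hs = l" "set hs \<subseteq> nary_part C m" "g = compose_op A m h hs"
    using qr by (auto simp: eqs minor_le_def)
  let ?ks = "map (\<lambda>u. compose_op A n u gs) hs"
  have "set ?ks \<subseteq> nary_part C n"
  proof
    fix k
    assume "k \<in> set ?ks"
    then obtain u where u: "u \<in> nary_part C m" "k = compose_op A n u gs"
      using hs(2) by auto
    then show "k \<in> nary_part C n"
      using C gs(1,2) nm unfolding clone_def by blast
  qed
  moreover have "f = compose_op A n h ?ks"
  proof
    fix xs
    have "u xs \<in> A" if "xs \<in> tuples A n" "u \<in> set gs" for u
    proof -
      have "(n, u) \<in> finitary_operations A"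
        using that(2) gs(2) C unfolding clone_def nary_part_def by blast
      then show ?thesis
        using that(1) unfolding finitary_operations_def operations_def by (auto intro: PiE_mem)
    qed
    then have "map (\<lambda>u. u xs) gs \<in> tuples A m" if "xs \<in> tuples A n"
      using that gs(1) by (auto simp: tuples_def)
    then show "f xs = compose_op A n h ?ks xs"
      unfolding gs(3) hs(3) compose_op_def by (simp add: o_def restrict_def)
  qed
  ultimately show ?thesis
    using hs(1) unfolding eqs minor_le_def by (auto intro!: exI[of _ ?ks])
qed

lemma equiv_minor_equiv:
  assumes "clone A C"
  shows "equiv (finitary_operations A) (minor_equiv A C)"
proof (rule equivI)
  show "minor_equiv A C \<subseteq> finitary_operations A \<times> finitary_operations A"
    by (auto simp: minor_equiv_def)
  show "refl_on (finitary_operations A) (minor_equiv A C)"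
    using minor_le_refl[OF assms] by (auto simp: minor_equiv_def refl_on_def)
  show "sym (minor_equiv A C)"
    by (auto simp: minor_equiv_def sym_def)
  show "trans (minor_equiv A C)"
    using minor_le_trans[OF assms] unfolding minor_equiv_def trans_def by blast
qed

end

(* Choose, in each class that contains n-ary operations, an n-ary representative g. Every n-ary
   operation of that class is g(h_1, ..., h_n) with the h_i in the n-ary part of C, so the class
   contains at most |C^(n)|^n of them. With d classes this gives k^(k^n) \<le> d |C^(n)|^n, and
   c = 1/d works because d^(1/n) \<le> d. *)
theory Submission
  imports Defs
begin

lemma card_tuples:
  assumes "finite A"
  shows "card (tuples A n) = card A ^ n"
  using card_lists_length_eq[OF assms, of n] by (simp add: tuples_def conj_commute)

lemma finite_tuples:
  assumes "finite A"
  shows "finite (tuples A n)"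
  using finite_lists_length_eq[OF assms, of n] by (simp add: tuples_def conj_commute)

lemma card_operations:
  assumes "finite A"
  shows "card (operations A n) = card A ^ (card A ^ n)"
  unfolding operations_def by (simp add: card_PiE finite_tuples card_tuples assms)

lemma finite_operations:
  assumes "finite A"
  shows "finite (operations A n)"
  unfolding operations_def by (intro finite_PiE finite_tuples assms)

lemma clone_nary_part_subset:
  assumes "clone A C"
  shows "nary_part C n \<subseteq> operations A n"
  using assms by (auto simp: clone_def nary_part_def finitary_operations_def)

text \<open>Every n-ary member of \<open>X\<close> lies below one n-ary \<open>g\<close> in
  \<open>X\<close>. As \<open>g\<close> has n argument places, such a member is determined by n
  operations from \<open>nary_part C n\<close>.\<close>

lemma card_nary_part_class_le:
  assumes "finite A" and "clone A C" and X: "X \<in> finitary_operations A // minor_equiv A C"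
  shows "card (nary_part X n) \<le> card (nary_part C n) ^ n"
\<comment> \<open>A class may have no n-ary member to serve as \<open>g\<close>; then the left side
  is 0.\<close>
proof (cases "nary_part X n = {}")
  case False
  then obtain g where g: "(n, g) \<in> X"
    by (auto simp: nary_part_def)
  have fin: "finite (nary_part C n)"
    using clone_nary_part_subset[OF assms(2)] finite_operations[OF assms(1)]
    by (rule finite_subset)
  \<comment> \<open>Here \<open>tuples\<close> has the operations in \<open>nary_part C n\<close> as
    its alphabet, so \<open>card_tuples\<close> counts the possible lists of inner
    operations.\<close>
  have "nary_part X n \<subseteq> compose_op A n g ` tuples (nary_part C n) n"
  proof
    fix f
    assume "f \<in> nary_part X n"
    then have "((n, f), (n, g)) \<in> minor_equiv A C"
      using quotient_eq_iff[OF equiv_minor_equiv[OF assms(2)] X X] g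
      by (auto simp: nary_part_def)
    then show "f \<in> compose_op A n g ` tuples (nary_part C n) n"
      by (auto simp: minor_equiv_def minor_le_def tuples_def)
  qed
  then have "card (nary_part X n) \<le> card (tuples (nary_part C n) n)"
    by (rule surj_card_le[OF finite_tuples[OF fin]])
  then show ?thesis
    by (simp add: card_tuples[OF fin])
qed simp

text \<open>A class may mix arities, so the union bound is applied to the n-ary parts of the
  classes, which together cover all n-ary operations since n is positive.\<close>

lemma card_operations_le_classes:
  assumes "finite A" and "clone A C" and "n \<ge> 1"
    and fin: "finite (finitary_operations A // minor_equiv A C)"
  shows "card (operations A n) \<le>
    card (finitary_operations A // minor_equiv A C) * card (nary_part C n) ^ n"
proof -
  let ?Q = "finitary_operations A // minor_equiv A C"
  have "operations A n = nary_part (\<Union>?Q) n"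
    unfolding Union_quotient[OF equiv_minor_equiv[OF assms(2)]]
    using assms(3) by (auto simp: nary_part_def finitary_operations_def)
  also have "\<dots> = (\<Union>X\<in>?Q. nary_part X n)"
    by (auto simp: nary_part_def)
  also have "card \<dots> \<le> (\<Sum>X\<in>?Q. card (nary_part X n))"
    by (rule card_UN_le[OF fin])
  also have "\<dots> \<le> card ?Q * card (nary_part C n) ^ n"
    using sum_bounded_above[OF card_nary_part_class_le[OF assms(1,2), where n = n]] by simp
  finally show ?thesis .
qed

theorem proposition3p3:
  fixes A :: "'a set" and k :: nat and C :: "'a operation set"
  assumes "finite A" and "card A = k" and "k \<ge> 1"
    and "clone A C"
    and "C \<in> finite_class_clones A"
  shows "\<exists>c::real. c > 0 \<and>
           (\<forall>n::nat. n \<ge> 1 \<longrightarrow>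
              real (card (nary_part C n)) \<ge> c * real k powr (real (k ^ n) / real n))"
proof -
  define d where "d = card (finitary_operations A // minor_equiv A C)"
  have fin: "finite (finitary_operations A // minor_equiv A C)"
    using assms(5) by (simp add: finite_class_clones_def)
  have bound: "k ^ (k ^ n) \<le> d * card (nary_part C n) ^ n" if "n \<ge> 1" for n
    using card_operations_le_classes[OF assms(1,4) that fin] card_operations[OF assms(1), of n]
    by (simp add: d_def assms(2))
  \<comment> \<open>With \<open>d = 0\<close> the bound at arity 1 would read
    \<open>k ^ k \<le> 0\<close>, impossible for positive \<open>k\<close>.\<close>
  have d: "d \<ge> 1"
    using bound[of 1] assms(3) by (cases d) auto
  have "1 / real d * real k powr (real (k ^ n) / real n) \<le> real (card (nary_part C n))"
    if n: "n \<ge> 1" for n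
  proof -
    define x where "x = real k powr (real (k ^ n) / real n)"
    have "x ^ n = real k ^ (k ^ n)"
      using n assms(3) unfolding x_def
      by (simp add: powr_powr flip: powr_realpow)
    also have "\<dots> \<le> real d * real (card (nary_part C n)) ^ n"
      using bound[OF n] by (metis of_nat_le_iff of_nat_mult of_nat_power)
    \<comment> \<open>Enlarging \<open>d\<close> to its n-th power makes the right side a perfect
      n-th power; after taking roots the factor is \<open>d\<close>, independent of n.\<close>
    also have "\<dots> \<le> real d ^ n * real (card (nary_part C n)) ^ n"
      using d n by (intro mult_right_mono self_le_power) auto
    finally have "x ^ n \<le> (real d * real (card (nary_part C n))) ^ n"
      by (simp add: power_mult_distrib)
    then have "x \<le> real d * real (card (nary_part C n))"
      \<comment> \<open>The rule compares powers with exponent \<open>Suc m\<close>, hence the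
        instance \<open>n - 1\<close>.\<close>
      using n by (auto intro: power_le_imp_le_base[of x "n - 1"])
    then show ?thesis
      using d by (simp add: x_def field_simps)
  qed
  then show ?thesis
    using d by (intro exI[of _ "1 / real d"]) auto
qed

end
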